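(* Let $n,m\ge 0$ be integers and let $\beta_k^{(n,m)}(a)$ ($0\le k\le n+m$) be the linearization coefficients of the Bessel polynomials, defined by $q_n(au)\,q_m((1-a)u)=\sum_{k=0}^{n+m}\beta_k^{(n,m)}(a)\,q_k(u)$. Then for every $k=0,1,\dots,n+m$, $$\beta_k^{(n,m)}(a)=a^{2n+m-k}(1-a)^{-n+k}\,\frac{(1/2)_{n+m-k}\,(1/2)_k}{(1/2)_n\,(1/2)_m}\sum_{j=0}^{2(n+m-k)}(-1)^j\binom{n+m+1}{2n+2m-2k-j}\binom{-m+k+j}{j}a^{-j}.$$ Equivalently, in terms of hypergeometric functions: (i) if $k\ge\lceil (n+m-1)/2\rceil$, then $$\beta_k^{(n,m)}(a)=a^{2n+m-k}(1-a)^{-n+k}\,\frac{(1/2)_{n+m-k}(1/2)_k}{(1/2)_n(1/2)_m}\binom{n+m+1}{2n+2m-2k}\;{}_2F_1\!\left(-2m-2n+2k,\,-m+k+1;\;2k-m-n+2;\;\tfrac1a\right);$$ (ii) if $k\le\lfloor (n+m-1)/2\rfloor$, then $$\beta_k^{(n,m)}(a)=(-1)^{n+m-1}a^{n+k+1}(1-a)^{-n+k}\,\frac{(1/2)_{n+m-k}(1/2)_k}{(1/2)_n(1/2)_m}\binom{n-k-1}{n+m-2k-1}\;{}_2F_1\!\left(-m-n-1,\,n-k;\;n+m-2k;\;\tfrac1a\right).$$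
   Context: Pochhammer symbol: $(z)_0=1$, $(z)_r=z(z+1)\cdots(z+r-1)$ for $z\in\mathbb{C}$ and integer $r\ge 1$. For an integer $n\ge0$ the (normalized) Bessel polynomial of degree $n$ is $$q_n(u)=\sum_{k=0}^n\frac{(-n)_k\,2^k}{(-2n)_k\,k!}\,u^k ,$$ so $q_0=1$, $q_1=1+u$, $q_2=1+u+u^2/3$. Since $q_k$ has degree $k$ for each $k$, the polynomial (in $u$) $q_n(au)q_m((1-a)u)$ has a unique expansion in $q_0,\dots,q_{n+m}$; its coefficients $\beta_k^{(n,m)}(a)$ are polynomials in $a$. Binomial coefficients are generalized: for an integer $x$ (possibly negative) and an integer $j\ge 0$, $\binom{x}{j}=x(x-1)\cdots(x-j+1)/j!$; $\binom{x}{j}=0$ for $j<0$. The hypergeometric function is ${}_2F_1(A,B;C;z)=\sum_{r\ge0}\frac{(A)_r(B)_r}{(C)_r\,r!}z^r$; all series in the claim terminate. The identities are understood as identities of rational functions in $a$ (in particular they hold for all complex $a\ne 0,1$). *)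

theory Defs
  imports Complex_Main "HOL-Computational_Algebra.Polynomial"
begin

definition bessel_poly :: "nat \<Rightarrow> complex poly" where
  "bessel_poly n =
     (\<Sum>k\<le>n. monom (pochhammer (- of_nat n) k * 2 ^ k /
                   (pochhammer (- 2 * of_nat n) k * fact k)) k)"

(* Coefficients of the expansion of q_n(a u) q_m((1-a) u) in q_0, ..., q_{n+m}, extended by 0
   beyond n + m. Lemma bessel_lin_coeff_ex1 shows that the description is well defined. *)
definition bessel_lin_coeff :: "nat \<Rightarrow> nat \<Rightarrow> complex \<Rightarrow> nat \<Rightarrow> complex" where
  "bessel_lin_coeff n m a =
     (THE c. (\<forall>k>n + m. c k = 0) \<and>
        pcompose (bessel_poly n) [:0, a:] * pcompose (bessel_poly m) [:0, 1 - a:] =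
        (\<Sum>k\<le>n + m. smult (c k) (bessel_poly k)))"

(* This is the usual function only where the series converges and no (C)_r vanishes. It is meant
   for a nonpositive integer A and a positive integer C, where the series is a finite sum. *)
definition hypergeo_2F1 :: "complex \<Rightarrow> complex \<Rightarrow> complex \<Rightarrow> complex \<Rightarrow> complex" where
  "hypergeo_2F1 A B C z =
     (\<Sum>r. pochhammer A r * pochhammer B r / (pochhammer C r * fact r) * z ^ r)"

lemma coeff_bessel_poly:
  "coeff (bessel_poly n) i =
     (if i \<le> n then pochhammer (- of_nat n) i * 2 ^ i /
        (pochhammer (- 2 * of_nat n) i * fact i) else 0)"
  by (simp add: bessel_poly_def coeff_sum sum.delta)

lemma degree_bessel_poly_le: "degree (bessel_poly n) \<le> n"
  by (rule degree_le) (simp add: coeff_bessel_poly)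

lemma lead_coeff_bessel_poly_nonzero: "coeff (bessel_poly n) n \<noteq> 0"
proof -
  have "pochhammer (- of_nat n :: complex) n \<noteq> 0"
    by (simp add: pochhammer_of_nat_eq_0_iff)
  moreover have "pochhammer (- of_nat (2 * n) :: complex) n \<noteq> 0"
    by (simp only: pochhammer_of_nat_eq_0_iff)
  ultimately show ?thesis
    by (simp add: coeff_bessel_poly)
qed

lemma bessel_expansion_exists:
  assumes "degree p \<le> N"
  shows "\<exists>c. (\<forall>k>N. c k = 0) \<and> p = (\<Sum>k\<le>N. smult (c k) (bessel_poly k))"
  using assms
proof (induction N arbitrary: p)
  case 0
  then obtain x where x: "p = [:x:]"
    by (auto elim: degree_eq_zeroE)
  have "p = smult x (bessel_poly 0)"
    by (simp add: x bessel_poly_def monom_0)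
  then show ?case
    by (intro exI[of _ "\<lambda>k. if k = 0 then x else 0"]) auto
next
  case (Suc N)
  let ?b = "bessel_poly (Suc N)"
  define x where "x = coeff p (Suc N) / coeff ?b (Suc N)"
  have "degree (p - smult x ?b) \<le> N"
  proof (rule degree_le, intro allI impI)
    fix i assume i: "N < i"
    show "coeff (p - smult x ?b) i = 0"
    proof (cases "i = Suc N")
      case True
      then show ?thesis
        using lead_coeff_bessel_poly_nonzero[of "Suc N"] by (simp add: x_def)
    next
      case False
      with i Suc.prems have "coeff p i = 0"
        by (intro coeff_eq_0) auto
      with i False show ?thesis
        by (simp add: coeff_bessel_poly)
    qed
  qed
  from Suc.IH[OF this] obtain c where c: "\<forall>k>N. c k = 0"
    "p - smult x ?b = (\<Sum>k\<le>N. smult (c k) (bessel_poly k))"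
    by blast
  have "p = (\<Sum>k\<le>N. smult (c k) (bessel_poly k)) + smult x ?b"
    by (simp flip: c(2))
  then show ?case
    using c(1) by (intro exI[of _ "c(Suc N := x)"]) auto
qed

lemma bessel_expansion_zero:
  assumes "(\<Sum>k\<le>N. smult (c k) (bessel_poly k)) = 0" "k \<le> N"
  shows "c k = 0"
  using assms
proof (induction N arbitrary: k)
  case 0
  then show ?case
    by (simp add: bessel_poly_def monom_0)
next
  case (Suc N)
  have "coeff (\<Sum>k\<le>Suc N. smult (c k) (bessel_poly k)) (Suc N) =
        c (Suc N) * coeff (bessel_poly (Suc N)) (Suc N)"
    by (simp add: coeff_sum coeff_bessel_poly)
  with Suc.prems(1) have top: "c (Suc N) = 0"
    using lead_coeff_bessel_poly_nonzero[of "Suc N"] by simp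
  then show ?case
    using Suc.IH[of k] Suc.prems by (cases "k = Suc N") auto
qed

lemma bessel_expansion_ex1:
  assumes "degree p \<le> N"
  shows "\<exists>!c. (\<forall>k>N. c k = 0) \<and> p = (\<Sum>k\<le>N. smult (c k) (bessel_poly k))"
proof (rule ex_ex1I)
  show "\<exists>c. (\<forall>k>N. c k = 0) \<and> p = (\<Sum>k\<le>N. smult (c k) (bessel_poly k))"
    using assms by (rule bessel_expansion_exists)
next
  fix c d
  assume c: "(\<forall>k>N. c k = 0) \<and> p = (\<Sum>k\<le>N. smult (c k) (bessel_poly k))"
    and d: "(\<forall>k>N. d k = 0) \<and> p = (\<Sum>k\<le>N. smult (d k) (bessel_poly k))"
  have "(\<Sum>k\<le>N. smult (c k - d k) (bessel_poly k)) =
        (\<Sum>k\<le>N. smult (c k) (bessel_poly k)) - (\<Sum>k\<le>N. smult (d k) (bessel_poly k))"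
    by (simp add: smult_diff_left sum_subtractf)
  also have "\<dots> = 0"
    using c d by simp
  finally have "c k - d k = 0" if "k \<le> N" for k
    using that bessel_expansion_zero[of "\<lambda>k. c k - d k"] by blast
  then show "c = d"
    using c d by (intro ext) (metis eq_iff_diff_eq_0 not_le)
qed

lemma bessel_lin_coeff_ex1:
  "\<exists>!c. (\<forall>k>n + m. c k = 0) \<and>
     pcompose (bessel_poly n) [:0, a:] * pcompose (bessel_poly m) [:0, 1 - a:] =
     (\<Sum>k\<le>n + m. smult (c k) (bessel_poly k))"
proof (rule bessel_expansion_ex1)
  have le: "degree (pcompose (bessel_poly l) [:0, x:]) \<le> l" for l x
  proof -
    have "degree (pcompose (bessel_poly l) [:0, x:]) \<le> degree (bessel_poly l) * degree [:0, x:]"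
      by (rule degree_pcompose_le)
    also have "\<dots> \<le> l * 1"
      using degree_bessel_poly_le by (intro mult_mono) auto
    finally show ?thesis by simp
  qed
  show "degree (pcompose (bessel_poly n) [:0, a:] * pcompose (bessel_poly m) [:0, 1 - a:]) \<le> n + m"
    using degree_mult_le le[of n a] le[of m "1 - a"] by (meson add_mono order_trans)
qed

lemma bessel_lin_coeff_expansion:
  "pcompose (bessel_poly n) [:0, a:] * pcompose (bessel_poly m) [:0, 1 - a:] =
   (\<Sum>k\<le>n + m. smult (bessel_lin_coeff n m a k) (bessel_poly k))"
  unfolding bessel_lin_coeff_def using theI'[OF bessel_lin_coeff_ex1[of n m a]] by blast

end

theory Submission
  imports Defs "HOL-Computational_Algebra.Polynomial_FPS"
begin

text \<open>
  Write \<open>b = 1 - a\<close> and \<open>N = n + m\<close>. Since \<open>(-1)^j binom(x + j, j) = binom(-x - 1, j)\<close>, the sum in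
  the theorem is a convolution of two binomial series, and the whole right-hand side equals
  \[ \frac{(1/2)_{N-k} (1/2)_k}{(1/2)_n (1/2)_m}\, a^{k-m} b^{k-n}\,
     [s^{2(N-k)}]\, (1 + a s)^{N+1} (1 + s)^{m-k-1} . \]
  This form, \<open>closed_form\<close> below, is the one for which the claim is proved.

  The Bessel polynomials satisfy \<open>q_(n+2) = q_(n+1) + u^2 q_n / ((2n+1)(2n+3))\<close>
  (\<open>bessel_poly_rec\<close>). Read with \<open>a u\<close> for \<open>u\<close>, this is a recurrence in \<open>n\<close> for the products
  \<open>q_n(a u) q_m(b u)\<close>; solved for \<open>u^2 q_k\<close>, it says how multiplication by \<open>u^2\<close> acts on the basis
  \<open>q_k\<close>. Together they turn the product recurrence into a recurrence for expansion coefficients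
  (\<open>bessel_expansion_three_term\<close>), and the same holds in \<open>m\<close> with \<open>b\<close> in place of \<open>a\<close>. So the
  claim reduces to four products with \<open>n, m \<le> 1\<close> and to the verification that the closed form obeys
  the two recurrences.

  After the powers and Pochhammer factors are cancelled, each of these becomes a linear relation
  between four coefficients of the series \<open>(1 + a s)^M' (1 + s)^p'\<close> whose exponents differ by small
  integers. All four series are multiples of one series \<open>H = (1 + a s)^M (1 + s)^p\<close> by polynomials
  of degree at most three, and the relation is the coefficient recurrence that expresses the
  differential equation \<open>(1 + a s)(1 + s) H' = (M a (1 + s) + p (1 + a s)) H\<close>
  (\<open>binomial_product_contiguous_left\<close> and \<open>binomial_product_contiguous_right\<close>).

  The hypergeometric forms are the same sum read term by term. If \<open>2 k \<ge> N - 1\<close>, the term \<open>j = 0\<close>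
  contains \<open>binom(N + 1, 2(N - k)) \<noteq> 0\<close> and is factored out; if \<open>2 k \<le> N - 1\<close>, the terms with
  \<open>j < N - 2k - 1\<close> vanish and the term \<open>j = N - 2k - 1\<close> is factored out.
\<close>

section \<open>The three-term recurrence of the Bessel polynomials\<close>

lemma bessel_poly_coeff_fact:
  assumes "n = i + d"
  shows "coeff (bessel_poly n) i = 2 ^ i * fact n * fact (2 * n - i) / (fact i * fact d * fact (2 * n))"
proof -
  have *: "pochhammer (- of_nat r :: complex) i = (- 1) ^ i * fact r / fact (r - i)" if "i \<le> r" for r
  proof -
    have "pochhammer (- of_nat r :: complex) i = (-1) ^ i * (of_nat r gchoose i) * fact i"
      by (simp add: gbinomial_pochhammer)
    also have "(of_nat r gchoose i :: complex) = fact r / (fact i * fact (r - i))"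
      using that by (simp add: binomial_fact flip: binomial_gbinomial)
    finally show ?thesis by simp
  qed
  have "pochhammer (- (2 * of_nat n) :: complex) i = (- 1) ^ i * fact (2 * n) / fact (2 * n - i)"
    using *[of "2 * n"] assms by simp
  then show ?thesis
    using *[of n] assms by (simp add: coeff_bessel_poly mult_ac)
qed

lemma of_nat_plus_1_neq_0: "of_nat r + 1 \<noteq> (0 :: complex)"
  using of_nat_neq_0[of r, where 'a = complex] by (simp only: of_nat_Suc add.commute not_False_eq_True)

lemma fact_step:
  "Suc r = s \<Longrightarrow> of_nat s = (y :: complex) \<Longrightarrow> fact s = y * fact r"
  by auto

lemma fact_step2:
  "Suc (Suc r) = s \<Longrightarrow> of_nat s = (y :: complex) \<Longrightarrow> of_nat (Suc r) = z \<Longrightarrow>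
     fact s = y * (z * fact r)"
  by auto

lemma bessel_poly_coeff_1: "coeff (bessel_poly (Suc n)) 1 = 1"
  using of_nat_plus_1_neq_0[of n] by (simp add: coeff_bessel_poly field_simps add_eq_0_iff)

lemma bessel_poly_lead_coeff_rec:
  "coeff (bessel_poly (n + 2)) (n + 2) =
     coeff (bessel_poly n) n / ((2 * of_nat n + 1) * (2 * of_nat n + 3))"
proof -
  define F :: complex where "F = fact (2 * n)"
  define f :: complex where "f = fact n"
  define x :: complex where "x = of_nat n"
  have f2: "fact (n + 2) = (x + 2) * (x + 1) * f"
    unfolding f_def mult.assoc by (rule fact_step2) (simp_all add: x_def)
  have F4: "fact (2 * (n + 2)) = 2 * (x + 2) * ((2 * x + 3) * (2 * (x + 1) * ((2 * x + 1) * F)))"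
  proof -
    have "fact (2 * n + 2) = 2 * (x + 1) * ((2 * x + 1) * F)"
      unfolding F_def by (rule fact_step2) (simp_all add: x_def)
    moreover have "fact (2 * (n + 2)) = 2 * (x + 2) * ((2 * x + 3) * fact (2 * n + 2))"
      by (rule fact_step2) (simp_all add: x_def)
    ultimately show ?thesis
      by (simp only:)
  qed
  have "F \<noteq> 0" "f \<noteq> 0"
    by (simp_all add: F_def f_def)
  moreover define u v where "u = x + 2" and "v = x + 1"
  moreover have "v \<noteq> 0" "u \<noteq> 0" "2 * x + 1 \<noteq> 0" "2 * x + 3 \<noteq> 0"
    using of_nat_plus_1_neq_0[of n] of_nat_plus_1_neq_0[of "n + 1"]
      of_nat_plus_1_neq_0[of "2 * n"] of_nat_plus_1_neq_0[of "2 * n + 2"]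
    by (simp_all add: x_def u_def v_def add_ac)
  moreover have e1: "coeff (bessel_poly (n + 2)) (n + 2) = 2 ^ (n + 2) * fact (n + 2) / fact (2 * (n + 2))"
  proof -
    have "n + 2 = n + 2 + 0" "2 * (n + 2) - (n + 2) = n + 2"
      by simp_all
    then show ?thesis
      using bessel_poly_coeff_fact[of "n + 2" "n + 2" 0] by (simp only: fact_0) (simp del: fact_Suc)
  qed
  moreover have e2: "coeff (bessel_poly n) n = 2 ^ n * f / F"
  proof -
    have "2 * n - n = n"
      by simp
    then show ?thesis
      using bessel_poly_coeff_fact[of n n 0] by (simp add: f_def F_def)
  qed
  ultimately show ?thesis
    unfolding e1 e2 f2 F4 x_def[symmetric] u_def[symmetric] v_def[symmetric] power_add
    by (simp add: divide_simps)
qed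

text \<open>
  The generic coefficient of \<open>bessel_poly_rec\<close>, parametrised by \<open>n = j + d + 1\<close> and the power
  \<open>i = j + 2\<close>, so that no truncated subtraction occurs and all three polynomials contribute.
\<close>
lemma bessel_poly_coeff_rec:
  "coeff (bessel_poly (j + d + 3)) (j + 2) = coeff (bessel_poly (j + d + 2)) (j + 2) +
     coeff (bessel_poly (j + d + 1)) j /
       ((2 * of_nat (j + d + 1) + 1) * (2 * of_nat (j + d + 1) + 3))"
proof -
  define x y p q :: complex
    where "x = of_nat j" and "y = of_nat d" and "p = 2 * x + 2 * y + 3" and "q = 2 * x + 2 * y + 5"
  define F where "F = (fact (j + 2 * d + 2) :: complex)"
  define G where "G = (fact (2 * j + 2 * d + 2) :: complex)"
  define K where "K = (fact (j + d + 1) :: complex)"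
  define W where "W = 2 ^ j * K * F / (fact j * fact d * G)"
  have g: "fact (j + d + 2) = (x + y + 2) * K"
    "fact (j + d + 3) = (x + y + 3) * ((x + y + 2) * K)"
    "fact (j + 2 * d + 4) = (x + 2 * y + 4) * ((x + 2 * y + 3) * F)"
    "fact (2 * j + 2 * d + 4) = 2 * (x + y + 2) * (p * G)"
    "fact (j + 2) = (x + 2) * ((x + 1) * fact j)" "fact (d + 1) = (y + 1) * fact d"
    unfolding K_def F_def G_def
    by (rule fact_step fact_step2; simp add: x_def y_def p_def; fail)+
  have "fact (2 * j + 2 * d + 6) = 2 * (x + y + 3) * (q * fact (2 * j + 2 * d + 4))"
    by (rule fact_step2) (simp_all add: x_def y_def q_def)
  note g = g this[unfolded g]
  have nz: "F \<noteq> 0" "G \<noteq> 0" "K \<noteq> 0" "fact j \<noteq> (0::complex)" "fact d \<noteq> (0::complex)"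
    by (simp_all only: F_def G_def K_def fact_nonzero not_False_eq_True)
  have pos: "x + 1 \<noteq> 0" "x + 2 \<noteq> 0" "y + 1 \<noteq> 0" "x + y + 2 \<noteq> 0" "x + y + 3 \<noteq> 0" "p \<noteq> 0" "q \<noteq> 0"
    using of_nat_plus_1_neq_0[of j] of_nat_plus_1_neq_0[of "j + 1"] of_nat_plus_1_neq_0[of d]
      of_nat_plus_1_neq_0[of "j + d + 1"] of_nat_plus_1_neq_0[of "j + d + 2"]
      of_nat_plus_1_neq_0[of "2 * j + 2 * d + 2"] of_nat_plus_1_neq_0[of "2 * j + 2 * d + 4"]
    by (simp_all add: x_def y_def p_def q_def add_ac)
  define s t where "s = x + y + 2" and "t = x + y + 3"
  have st: "s \<noteq> 0" "t \<noteq> 0"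
    using pos by (simp_all only: s_def t_def not_False_eq_True)
  have idx: "j + d + 3 = j + 2 + (d + 1)" "j + d + 2 = j + 2 + d" "j + d + 1 = j + (d + 1)"
    "2 * (j + 2 + (d + 1)) = 2 * j + 2 * d + 6" "2 * j + 2 * d + 6 - (j + 2) = j + 2 * d + 4"
    "2 * (j + 2 + d) = 2 * j + 2 * d + 4" "2 * j + 2 * d + 4 - (j + 2) = j + 2 * d + 2"
    "2 * (j + (d + 1)) = 2 * j + 2 * d + 2" "2 * j + 2 * d + 2 - j = j + 2 * d + 2"
    by simp_all
  have "coeff (bessel_poly (j + d + 3)) (j + 2) =
      2 ^ (j + 2) * fact (j + d + 3) * fact (j + 2 * d + 4) /
      (fact (j + 2) * fact (d + 1) * fact (2 * j + 2 * d + 6))"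
    using bessel_poly_coeff_fact[of "j + 2 + (d + 1)" "j + 2" "d + 1", OF refl] by (simp only: idx)
  also have "\<dots> = W * ((x + 2 * y + 4) * (x + 2 * y + 3) / ((x + 2) * (x + 1) * (y + 1) * p * q))"
    unfolding g W_def s_def[symmetric] t_def[symmetric] using pos nz st by (simp add: divide_simps power_add)
  finally have e1: "coeff (bessel_poly (j + d + 3)) (j + 2) = \<dots>" .
  have "coeff (bessel_poly (j + d + 2)) (j + 2) =
      2 ^ (j + 2) * fact (j + d + 2) * fact (j + 2 * d + 2) /
      (fact (j + 2) * fact d * fact (2 * j + 2 * d + 4))"
    using bessel_poly_coeff_fact[of "j + 2 + d" "j + 2" d, OF refl] by (simp only: idx)
  also have "\<dots> = W * (2 / ((x + 2) * (x + 1) * p))"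
    unfolding g W_def F_def[symmetric] s_def[symmetric] using pos nz st by (simp add: divide_simps power_add)
  finally have e2: "coeff (bessel_poly (j + d + 2)) (j + 2) = \<dots>" .
  have "coeff (bessel_poly (j + d + 1)) j =
      2 ^ j * fact (j + d + 1) * fact (j + 2 * d + 2) / (fact j * fact (d + 1) * fact (2 * j + 2 * d + 2))"
    using bessel_poly_coeff_fact[of "j + (d + 1)" j "d + 1", OF refl] by (simp only: idx)
  also have "\<dots> = W * (1 / (y + 1))"
    unfolding g W_def F_def[symmetric] G_def[symmetric] K_def[symmetric] using pos nz
    by (simp add: divide_simps)
  finally have e3: "coeff (bessel_poly (j + d + 1)) j = \<dots>" .
  have pq: "2 * of_nat (j + d + 1) + 1 = p" "2 * of_nat (j + d + 1) + 3 = q"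
    by (simp_all add: x_def y_def p_def q_def)
  \<comment> \<open>After the common factor \<open>W\<close> is removed, the recurrence is this polynomial identity.\<close>
  have "(x + 2 * y + 4) * (x + 2 * y + 3) = 2 * (y + 1) * q + (x + 2) * (x + 1)"
    by (simp add: q_def algebra_simps)
  then have "(x + 2 * y + 4) * (x + 2 * y + 3) / ((x + 2) * (x + 1) * (y + 1) * p * q) =
      2 / ((x + 2) * (x + 1) * p) + 1 / (y + 1) / (p * q)"
    using pos by (simp add: divide_simps)
  then show ?thesis
    unfolding e1 e2 e3 pq by (simp only: times_divide_eq_right distrib_left)
qed

text \<open>
  The recurrence that drives the whole proof. It is the recurrence of the modified Bessel functions
  \<open>K_(n+1/2)\<close>, to which \<open>q_n\<close> is proportional up to elementary factors.
\<close>
lemma bessel_poly_rec: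
  "bessel_poly (n + 2) = bessel_poly (n + 1) +
     smult (1 / ((2 * of_nat n + 1) * (2 * of_nat n + 3))) (monom 1 2 * bessel_poly n)"
proof (rule poly_eqI)
  fix i
  consider "i = 0" | "i = 1" | j where "i = j + 2" "n < j" | "i = n + 2"
    | j d where "i = j + 2" "n = j + d + 1"
    by (metis add_2_eq_Suc' less_imp_Suc_add linorder_neqE_nat
        not0_implies_Suc One_nat_def add_Suc_right Suc_eq_plus1)
  then show "coeff (bessel_poly (n + 2)) i = coeff (bessel_poly (n + 1) +
     smult (1 / ((2 * of_nat n + 1) * (2 * of_nat n + 3))) (monom 1 2 * bessel_poly n)) i"
  proof cases
    case 2
    then show ?thesis
      using bessel_poly_coeff_1[of n] bessel_poly_coeff_1[of "Suc n"] by (simp add: coeff_monom_mult)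
  next
    case 4
    then show ?thesis
      using bessel_poly_lead_coeff_rec[of n] by (simp add: coeff_monom_mult coeff_bessel_poly[of "Suc n"])
  next
    case (5 j d)
    then show ?thesis
      using bessel_poly_coeff_rec[of j d] by (simp add: coeff_monom_mult eval_nat_numeral)
  qed (simp_all add: coeff_bessel_poly coeff_monom_mult)
qed

section \<open>Coefficients of a product of two binomial series\<close>

definition binomial_product :: "complex \<Rightarrow> nat \<Rightarrow> complex \<Rightarrow> complex fps" where
  "binomial_product a N p = (1 + fps_const a * fps_X) ^ N * fps_binomial p"

lemma binomial_product_Suc:
  "binomial_product a (Suc N) p = binomial_product a N p * (1 + fps_const a * fps_X)"
  by (simp add: binomial_product_def mult_ac)

lemma binomial_product_add_1:
  "binomial_product a N (p + 1) = binomial_product a N p * (1 + fps_X)"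
  by (simp add: binomial_product_def fps_binomial_add_mult fps_binomial_1 mult_ac)

lemma fps_nth_mult_linear_Suc:
  fixes f :: "'a::comm_ring_1 fps"
  shows
  "fps_nth (f * (1 + fps_const c * fps_X)) (Suc d) = fps_nth f (Suc d) + c * fps_nth f d"
proof -
  have "f * (1 + fps_const c * fps_X) = f + fps_const c * (fps_X * f)"
    by (simp only: distrib_left mult_1_right mult_1_left mult.commute mult.left_commute)
  then show ?thesis
    by simp
qed

lemma fps_nth_mult_one_plus_X_Suc:
  fixes f :: "'a::comm_ring_1 fps"
  shows "fps_nth (f * (1 + fps_X)) (Suc d) = fps_nth f (Suc d) + fps_nth f d"
  using fps_nth_mult_linear_Suc[of f 1] by simp

lemma power_deriv_linear:
  fixes A :: "'a::comm_ring_1 fps"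
  assumes "fps_deriv A = fps_const a"
  shows "A * fps_deriv (A ^ N) = fps_const (of_nat N * a) * A ^ N"
proof (induction N)
  case (Suc N)
  have "A * fps_deriv (A ^ Suc N) = fps_const a * A ^ Suc N + A * (A * fps_deriv (A ^ N))"
    by (simp add: assms distrib_left mult_ac)
  also have "\<dots> = fps_const a * A ^ Suc N + fps_const (of_nat N * a) * A ^ Suc N"
    by (simp add: Suc.IH mult_ac)
  also have "\<dots> = (fps_const a + fps_const (of_nat N * a)) * A ^ Suc N"
    by (simp only: distrib_right)
  also have "fps_const a + fps_const (of_nat N * a) = fps_const (of_nat (Suc N) * a)"
    by (simp add: distrib_right)
  finally show ?case .
qed simp

lemma binomial_product_ode:
  "(1 + fps_const a * fps_X) * (1 + fps_X) * fps_deriv (binomial_product a N p) =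
   (fps_const (of_nat N * a) * (1 + fps_X) + fps_const p * (1 + fps_const a * fps_X)) *
     binomial_product a N p"
proof -
  let ?A = "1 + fps_const a * fps_X :: complex fps"
  have dA: "?A * fps_deriv (?A ^ N) = fps_const (of_nat N * a) * ?A ^ N"
    by (rule power_deriv_linear) simp
  have dB: "(1 + fps_X) * fps_deriv (fps_binomial p) = fps_const p * fps_binomial p"
  proof -
    have "(1 + fps_X) * inverse (1 + fps_X :: complex fps) = 1"
      by (rule inverse_mult_eq_1') simp
    then show ?thesis
      by (simp add: fps_binomial_deriv fps_divide_unit mult.left_commute)
  qed
  have "?A * (1 + fps_X) * fps_deriv (binomial_product a N p) =
     (?A * fps_deriv (?A ^ N)) * ((1 + fps_X) * fps_binomial p) +
     (?A * ?A ^ N) * ((1 + fps_X) * fps_deriv (fps_binomial p))"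
    unfolding binomial_product_def fps_deriv_mult by (simp only: algebra_simps)
  also have "\<dots> = (fps_const (of_nat N * a) * (1 + fps_X) + fps_const p * ?A) *
     (?A ^ N * fps_binomial p)"
    unfolding dA dB by (simp only: algebra_simps)
  finally show ?thesis
    by (simp only: binomial_product_def)
qed

text \<open>
  The differential equation read at \<open>s^d\<close>. The coefficient of \<open>s^(d-1)\<close> is written as that of
  \<open>s^d\<close> in \<open>X H\<close>, which is \<open>0\<close> for \<open>d = 0\<close>, so the recurrence holds for every \<open>d\<close>.
\<close>
lemma binomial_product_coeff_rec:
  fixes a p :: complex and N d :: nat
  defines "H \<equiv> binomial_product a N p"
  shows "of_nat (d + 1) * fps_nth H (d + 1) + (1 + a) * of_nat d * fps_nth H d +
       a * (of_nat d - 1) * fps_nth (fps_X * H) d =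
     (of_nat N * a + p) * fps_nth H d + a * (of_nat N + p) * fps_nth (fps_X * H) d"
proof -
  have "fps_deriv H + fps_const (1 + a) * (fps_X * fps_deriv H) +
        fps_const a * (fps_X * (fps_X * fps_deriv H)) =
        fps_const (of_nat N * a + p) * H + fps_const (a * (of_nat N + p)) * (fps_X * H)"
  proof -
    have const_simps: "fps_const (1 + a) = 1 + fps_const a"
      "fps_const (of_nat N * a + p) = fps_const (of_nat N * a) + fps_const p"
      "fps_const (a * (of_nat N + p)) = fps_const (of_nat N * a) + fps_const p * fps_const a"
      by (simp_all add: algebra_simps del: fps_const_1_eq_1 flip: fps_const_1_eq_1)
    show ?thesis
      using binomial_product_ode[of a N p, folded H_def] unfolding const_simps by algebra
  qed
  then have "fps_nth (fps_deriv H + fps_const (1 + a) * (fps_X * fps_deriv H) +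
        fps_const a * (fps_X * (fps_X * fps_deriv H))) d =
     fps_nth (fps_const (of_nat N * a + p) * H + fps_const (a * (of_nat N + p)) * (fps_X * H)) d"
    by simp
  then have eq: "fps_nth (fps_deriv H) d + (1 + a) * fps_nth (fps_X * fps_deriv H) d +
        a * fps_nth (fps_X * (fps_X * fps_deriv H)) d =
     (of_nat N * a + p) * fps_nth H d + a * (of_nat N + p) * fps_nth (fps_X * H) d"
    by (simp only: fps_add_nth fps_mult_left_const_nth)
  have "fps_nth (fps_deriv H) d = of_nat (d + 1) * fps_nth H (d + 1)"
    by simp
  moreover have "fps_nth (fps_X * fps_deriv H) d = of_nat d * fps_nth H d"
    by (cases d) simp_all
  moreover have "fps_nth (fps_X * (fps_X * fps_deriv H)) d = (of_nat d - 1) * fps_nth (fps_X * H) d"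
    by (cases d; cases "d - 1") simp_all
  ultimately show ?thesis
    using eq by (simp only: mult.assoc)
qed

text \<open>
  The recurrence of the closed form in \<open>n\<close>, \<open>n + 1\<close>, \<open>n + 2\<close>, stripped of its elementary factors. In
  that recurrence \<open>l + k = n + m + 1\<close> and \<open>p = m - k - 1\<close>, so that \<open>2 l - 2 p - 1\<close> is \<open>2 n + 3\<close>.
  Since \<open>(1 + a s)^2 - (1 + s)^2\<close> is divisible by \<open>(1 - a) s\<close>, the difference of the two coefficients
  at \<open>2 l + 2\<close> involves only lower coefficients of \<open>H\<close>, which the differential equation relates.
\<close>
lemma binomial_product_contiguous_left:
  fixes a p :: complex and l k :: nat
  shows "(2 * of_nat l + 1) * fps_nth (binomial_product a (l + k + 2) p) (2 * l + 2) =
     (2 * of_nat l - 2 * p - 1) * (1 - a) * fps_nth (binomial_product a (l + k + 1) p) (2 * l) +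
     (2 * of_nat l + 1) * fps_nth (binomial_product a (l + k) (p + 2)) (2 * l + 2) -
     (2 * of_nat k + 1) * a * (1 - a) * fps_nth (binomial_product a (l + k) (p + 1)) (2 * l)"
proof -
  define H where "H = binomial_product a (l + k) p"
  have p2: "p + 2 = (p + 1) + 1"
    by simp
  have shift: "fps_nth (H * (1 + fps_const c * fps_X)) (2 * l) =
      fps_nth H (2 * l) + c * fps_nth (fps_X * H) (2 * l)" for c
    by (cases l) (simp_all add: fps_nth_mult_linear_Suc)
  have X1: "fps_nth (binomial_product a (l + k + 2) p) (2 * l + 2) =
      fps_nth H (2 * l + 2) + 2 * a * fps_nth H (2 * l + 1) + a\<^sup>2 * fps_nth H (2 * l)"
    by (simp add: binomial_product_Suc fps_nth_mult_linear_Suc power2_eq_square flip: H_def)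
       (simp add: algebra_simps)
  have X2: "fps_nth (binomial_product a (l + k + 1) p) (2 * l) =
      fps_nth H (2 * l) + a * fps_nth (fps_X * H) (2 * l)"
    by (simp add: binomial_product_Suc shift flip: H_def)
  have X3: "fps_nth (binomial_product a (l + k) (p + 2)) (2 * l + 2) =
      fps_nth H (2 * l + 2) + 2 * fps_nth H (2 * l + 1) + fps_nth H (2 * l)"
  proof -
    have "binomial_product a (l + k) (p + 2) = H * (1 + fps_X) * (1 + fps_X)"
      unfolding p2 binomial_product_add_1 H_def ..
    then show ?thesis
      by (simp add: fps_nth_mult_one_plus_X_Suc)
  qed
  have X4: "fps_nth (binomial_product a (l + k) (p + 1)) (2 * l) =
      fps_nth H (2 * l) + fps_nth (fps_X * H) (2 * l)"
    using shift[of 1] by (simp add: binomial_product_add_1 flip: H_def)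
  show ?thesis
    unfolding X1 X2 X3 X4
    using binomial_product_coeff_rec[of "2 * l" a "l + k" p, folded H_def]
    unfolding of_nat_add of_nat_mult of_nat_numeral of_nat_1 by algebra
qed

text \<open>
  The analogous relation for the recurrence in \<open>m\<close>, where \<open>l + k = n + m + 1\<close>, \<open>p = m - k\<close> and
  \<open>2 p + 2 k + 3\<close> is \<open>2 m + 3\<close>; now \<open>(1 + a s)^2 - 1 = a s (2 + a s)\<close> removes the
  coefficient of \<open>H\<close> at \<open>2 l + 2\<close>.
\<close>
lemma binomial_product_contiguous_right:
  fixes a p :: complex and l k :: nat
  shows "(2 * of_nat l + 1) * fps_nth (binomial_product a (l + k + 2) (p + 1)) (2 * l + 2) =
     (2 * p + 2 * of_nat k + 3) * a * fps_nth (binomial_product a (l + k + 1) p) (2 * l) +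
     (2 * of_nat l + 1) * fps_nth (binomial_product a (l + k) (p + 1)) (2 * l + 2) -
     (2 * of_nat k + 1) * a * (1 - a) * fps_nth (binomial_product a (l + k) p) (2 * l)"
proof -
  define H where "H = binomial_product a (l + k) p"
  have shift: "fps_nth (H * (1 + fps_const c * fps_X)) (2 * l) =
      fps_nth H (2 * l) + c * fps_nth (fps_X * H) (2 * l)" for c
    by (cases l) (simp_all add: fps_nth_mult_linear_Suc)
  have Y3: "fps_nth (binomial_product a (l + k) (p + 1)) (2 * l + 2) =
      fps_nth H (2 * l + 2) + fps_nth H (2 * l + 1)"
    by (simp add: binomial_product_add_1 fps_nth_mult_one_plus_X_Suc flip: H_def)
  have *: "fps_nth (binomial_product a (l + k) (p + 1)) (2 * l) =
      fps_nth H (2 * l) + fps_nth (fps_X * H) (2 * l)"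
    using shift[of 1] by (simp add: binomial_product_add_1 flip: H_def)
  have **: "fps_nth (binomial_product a (l + k) (p + 1)) (Suc (2 * l)) =
      fps_nth H (2 * l + 1) + fps_nth H (2 * l)"
    by (simp add: binomial_product_add_1 fps_nth_mult_one_plus_X_Suc flip: H_def)
  have Y1: "fps_nth (binomial_product a (l + k + 2) (p + 1)) (2 * l + 2) =
      fps_nth H (2 * l + 2) + fps_nth H (2 * l + 1) + 2 * a * (fps_nth H (2 * l + 1) + fps_nth H (2 * l))
       + a\<^sup>2 * (fps_nth H (2 * l) + fps_nth (fps_X * H) (2 * l))"
  proof -
    have "fps_nth (binomial_product a (l + k + 2) (p + 1)) (2 * l + 2) =
        fps_nth (binomial_product a (l + k) (p + 1)) (2 * l + 2) +
        2 * a * fps_nth (binomial_product a (l + k) (p + 1)) (Suc (2 * l)) +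
        a\<^sup>2 * fps_nth (binomial_product a (l + k) (p + 1)) (2 * l)"
      by (simp add: binomial_product_Suc fps_nth_mult_linear_Suc power2_eq_square)
         (simp add: ring_distribs mult_ac)
    then show ?thesis
      by (simp only: Y3 * **)
  qed
  have Y2: "fps_nth (binomial_product a (l + k + 1) p) (2 * l) =
      fps_nth H (2 * l) + a * fps_nth (fps_X * H) (2 * l)"
    by (simp add: binomial_product_Suc shift flip: H_def)
  show ?thesis
    unfolding Y1 Y2 Y3 H_def[symmetric]
    using binomial_product_coeff_rec[of "2 * l" a "l + k" p, folded H_def]
    unfolding of_nat_add of_nat_mult of_nat_numeral of_nat_1 by algebra
qed

text \<open>
  For a natural exponent the series is a polynomial. This makes the terms that would carry a negative
  index \<open>k - 1\<close> or \<open>k - 2\<close> in the recurrences disappear.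
\<close>
lemma binomial_product_coeff_eq_0:
  assumes "N + p < d"
  shows "fps_nth (binomial_product a N (of_nat p)) d = 0"
proof -
  have "binomial_product a N (of_nat p) = fps_of_poly ([:1, a:] ^ N * [:1, 1:] ^ p)"
    by (simp add: binomial_product_def fps_binomial_of_nat fps_of_poly_mult fps_of_poly_power
        fps_of_poly_pCons mult_ac)
  moreover have "degree ([:1, a:] ^ N * [:1, 1:] ^ p) \<le> N + p"
    by (intro order.trans[OF degree_mult_le] add_mono order.trans[OF degree_power_le]) auto
  ultimately show ?thesis
    using assms by (simp add: coeff_eq_0)
qed

lemma binomial_product_nth:
  "fps_nth (binomial_product a N p) d =
     (\<Sum>j = 0..d. (of_nat N gchoose (d - j)) * a ^ (d - j) * (p gchoose j))"
proof -
  have "(1 + fps_const a * fps_X) ^ N = Abs_fps (\<lambda>i. (of_nat N gchoose i) * a ^ i)"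
  proof (induction N)
    case 0
    show ?case
      by (auto simp: fps_eq_iff gbinomial_0_left)
  next
    case (Suc N)
    show ?case
    proof (rule fps_ext)
      fix i
      show "fps_nth ((1 + fps_const a * fps_X) ^ Suc N) i =
          fps_nth (Abs_fps (\<lambda>i. (of_nat (Suc N) gchoose i) * a ^ i)) i"
      proof (cases i)
        case (Suc j)
        then show ?thesis
          using fps_nth_mult_linear_Suc[of "(1 + fps_const a * fps_X) ^ N" a j]
            gbinomial_Suc_Suc[of "of_nat N :: complex" j]
          unfolding power_Suc2 Suc.IH Suc by (simp add: add.commute distrib_left distrib_right mult_ac)
      qed (simp add: Suc.IH)
    qed
  qed
  then show ?thesis
    by (simp add: binomial_product_def fps_mult_nth mult.commute sum.nat_diff_reindex[symmetric])
qed

lemma binomial_product_nth_0: "fps_nth (binomial_product a N p) 0 = 1"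
  by (simp add: binomial_product_nth)

section \<open>The closed form of the coefficients\<close>

text \<open>
  The elementary factor of the closed form, with \<open>b\<close> for \<open>1 - a\<close> and \<open>l\<close> for \<open>n + m - k\<close>. Keeping \<open>b\<close> and
  \<open>l\<close> independent makes it symmetric under exchange of \<open>(a, n)\<close> and \<open>(b, m)\<close>, so that the step lemmas
  below serve both recurrences.
\<close>
definition weight :: "complex \<Rightarrow> complex \<Rightarrow> nat \<Rightarrow> nat \<Rightarrow> nat \<Rightarrow> nat \<Rightarrow> complex" where
  "weight a b n m k l = pochhammer (1/2) l * pochhammer (1/2) k /
     (pochhammer (1/2) n * pochhammer (1/2) m) * a powi (int k - int m) * b powi (int k - int n)"

definition closed_form :: "complex \<Rightarrow> nat \<Rightarrow> nat \<Rightarrow> nat \<Rightarrow> complex" where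
  "closed_form a n m k =
     (if k \<le> n + m then weight a (1 - a) n m k (n + m - k) *
        fps_nth (binomial_product a (n + m + 1) (of_int (int m - int k - 1))) (2 * (n + m - k))
      else 0)"

text \<open>
  Naming the difference \<open>l = n + m - k\<close> keeps truncated subtraction out of the recurrences.
\<close>
lemma closed_form_eq:
  assumes "n + m = l + k"
  shows "closed_form a n m k = weight a (1 - a) n m k l *
    fps_nth (binomial_product a (l + k + 1) (of_int (int m - int k - 1))) (2 * l)"
  using assms by (simp add: closed_form_def)

lemma weight_commute: "weight a b n m k l = weight b a m n k l"
  by (simp add: weight_def mult_ac)

lemma pochhammer_half_neq_0: "pochhammer (1/2) n \<noteq> (0 :: complex)"
proof
  assume "pochhammer (1/2) n = (0 :: complex)"
  then obtain k where "1/2 = - (of_nat k :: complex)"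
    by (auto simp: pochhammer_eq_0_iff)
  then have "Re (1/2) = Re (- of_nat k)" by (rule arg_cong)
  then show False by simp
qed

lemma pochhammer_half_Suc:
  "pochhammer (1/2) (Suc n) = (2 * of_nat n + 1) / 2 * (pochhammer (1/2) n :: complex)"
  by (simp add: pochhammer_Suc field_simps)

lemma two_of_nat_plus_odd_neq_0:
  "2 * of_nat n + 1 \<noteq> (0 :: complex)" "2 * of_nat n + 3 \<noteq> (0 :: complex)"
  using of_nat_plus_1_neq_0[of "2 * n"] of_nat_plus_1_neq_0[of "2 * n + 2"]
  by (simp_all add: add_ac)

text \<open>
  All four weights are multiples of one factor \<open>C\<close>; dividing by it turns the recurrence for the
  coefficients into the contiguous relation \<open>rel\<close>. The next three lemmas are the boundary cases:
  for \<open>k = 1\<close> and \<open>k = 0\<close> terms with negative index are absent, and for the top index two of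
  the four terms remain.
\<close>
lemma weight_step:
  assumes "a \<noteq> 0" "b \<noteq> 0"
    and rel: "(2 * of_nat l + 1) * X1 = (2 * of_nat n + 3) * b * X2 + (2 * of_nat l + 1) * X3 -
      (2 * of_nat j + 5) * a * b * X4"
  shows "weight a b (n + 2) m (j + 2) (l + 1) * X1 = weight a b (n + 1) m (j + 2) l * X2 +
      a\<^sup>2 / ((2 * of_nat n + 1) * (2 * of_nat n + 3)) *
      ((2 * of_nat j + 1) * (2 * of_nat j + 3) * (weight a b n m j (l + 1) * X3) -
       (2 * of_nat j + 3) * (2 * of_nat j + 5) * (weight a b n m (j + 1) l * X4))"
proof -
  define A B where "A = a powi (int j - int m)" and "B = b powi (int j - int n)"
  define hl hj hn hm :: complex where "hl = pochhammer (1/2) l" and "hj = pochhammer (1/2) j"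
    and "hn = pochhammer (1/2) n" and "hm = pochhammer (1/2) m"
  note defs = A_def B_def hl_def hj_def hn_def hm_def
  have nz: "A \<noteq> 0" "B \<noteq> 0" "hl \<noteq> 0" "hj \<noteq> 0" "hn \<noteq> 0" "hm \<noteq> 0"
    "2 * of_nat n + 1 \<noteq> (0 :: complex)" "2 * of_nat n + 3 \<noteq> (0 :: complex)"
    using assms two_of_nat_plus_odd_neq_0[of n] by (simp_all add: defs pochhammer_half_neq_0)
  have pw: "a powi (int (j + 2) - int m) = a\<^sup>2 * A" "a powi (int (j + 1) - int m) = a * A"
    "b powi (int (j + 2) - int (n + 2)) = B" "b powi (int (j + 2) - int (n + 1)) = b * B"
    "b powi (int (j + 1) - int n) = b * B"
    using assms by (simp_all add: defs power_int_diff power_int_add field_simps power2_eq_square)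
  define C where "C = hl * hj * (2 * of_nat j + 1) * (2 * of_nat j + 3) * a\<^sup>2 * A * B /
    (2 * hn * (2 * of_nat n + 1) * (2 * of_nat n + 3) * hm)"
  have "weight a b (n + 2) m (j + 2) (l + 1) = C * (2 * of_nat l + 1)"
    "weight a b (n + 1) m (j + 2) l = C * (2 * of_nat n + 3) * b"
    "a\<^sup>2 / ((2 * of_nat n + 1) * (2 * of_nat n + 3)) *
      ((2 * of_nat j + 1) * (2 * of_nat j + 3) * weight a b n m j (l + 1)) = C * (2 * of_nat l + 1)"
    "a\<^sup>2 / ((2 * of_nat n + 1) * (2 * of_nat n + 3)) *
      ((2 * of_nat j + 3) * (2 * of_nat j + 5) * weight a b n m (j + 1) l) =
      C * (2 * of_nat j + 5) * a * b"
    unfolding weight_def pw C_def using nz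
    by (simp_all add: pochhammer_half_Suc flip: defs) (simp_all add: field_simps power2_eq_square)
  then show ?thesis
    using rel by algebra
qed

lemma weight_step_1:
  assumes "a \<noteq> 0" "b \<noteq> 0"
    and rel: "(2 * of_nat l + 1) * X1 = (2 * of_nat n + 3) * b * X2 - 3 * a * b * X4"
  shows "weight a b (n + 2) m 1 (l + 1) * X1 = weight a b (n + 1) m 1 l * X2 -
      a\<^sup>2 / ((2 * of_nat n + 1) * (2 * of_nat n + 3)) * (3 * (weight a b n m 0 l * X4))"
proof -
  define A B where "A = a powi (- int m)" and "B = b powi (- int n)"
  define hl hn hm :: complex where "hl = pochhammer (1/2) l"
    and "hn = pochhammer (1/2) n" and "hm = pochhammer (1/2) m"
  note defs = A_def B_def hl_def hn_def hm_def
  have nz: "A \<noteq> 0" "B \<noteq> 0" "hl \<noteq> 0" "hn \<noteq> 0" "hm \<noteq> 0"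
    "2 * of_nat n + 1 \<noteq> (0 :: complex)" "2 * of_nat n + 3 \<noteq> (0 :: complex)"
    using assms two_of_nat_plus_odd_neq_0[of n] by (simp_all add: defs pochhammer_half_neq_0)
  have pw: "a powi (int 1 - int m) = a * A" "a powi (int 0 - int m) = A"
    "b powi (int 1 - int (n + 2)) = B / b" "b powi (int 1 - int (n + 1)) = B"
    "b powi (int 0 - int n) = B"
    using assms by (simp_all add: defs power_int_diff power_int_add power_int_minus field_simps power2_eq_square)
  define C where "C = hl * a * A * B /
    (hn * (2 * of_nat n + 1) * (2 * of_nat n + 3) * hm * b)"
  have "weight a b (n + 2) m 1 (l + 1) = C * (2 * of_nat l + 1)"
    "weight a b (n + 1) m 1 l = C * (2 * of_nat n + 3) * b"
    "a\<^sup>2 / ((2 * of_nat n + 1) * (2 * of_nat n + 3)) * (3 * weight a b n m 0 l) = C * 3 * a * b"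
    unfolding weight_def pw C_def using nz assms(1,2)
    by (simp_all add: pochhammer_half_Suc flip: defs) (simp_all add: field_simps power2_eq_square)
  then show ?thesis
    using rel by algebra
qed

lemma weight_step_0:
  assumes "b \<noteq> 0"
    and rel: "(2 * of_nat l + 1) * X1 = (2 * of_nat n + 3) * b * X2"
  shows "weight a b (n + 2) m 0 (l + 1) * X1 = weight a b (n + 1) m 0 l * X2"
proof -
  define A B where "A = a powi (- int m)" and "B = b powi (- int n)"
  have pw: "a powi (int 0 - int m) = A" "b powi (int 0 - int (n + 2)) = B / b / b"
    "b powi (int 0 - int (n + 1)) = B / b"
    using assms by (simp_all add: A_def B_def power_int_diff power_int_minus field_simps power2_eq_square)
  define hl hn hm :: complex where "hl = pochhammer (1/2) l"
    and "hn = pochhammer (1/2) n" and "hm = pochhammer (1/2) m"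
  note defs = hl_def hn_def hm_def
  have nz: "hl \<noteq> 0" "hn \<noteq> 0" "hm \<noteq> 0"
    "2 * of_nat n + 1 \<noteq> (0 :: complex)" "2 * of_nat n + 3 \<noteq> (0 :: complex)"
    using two_of_nat_plus_odd_neq_0[of n] by (simp_all add: defs pochhammer_half_neq_0)
  define C where "C = 2 * hl * A * B / (hn * (2 * of_nat n + 1) * (2 * of_nat n + 3) * hm * b\<^sup>2)"
  have "weight a b (n + 2) m 0 (l + 1) = C * (2 * of_nat l + 1)"
    "weight a b (n + 1) m 0 l = C * (2 * of_nat n + 3) * b"
    unfolding weight_def pw C_def using nz assms(1)
    by (simp_all add: pochhammer_half_Suc flip: defs)
       (simp_all add: divide_simps power2_eq_square add.commute[of 3])
  then show ?thesis
    using rel by algebra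
qed

lemma weight_step_top:
  assumes "a \<noteq> 0" "b \<noteq> 0"
  shows "weight a b (n + 2) m (j + 2) 0 = a\<^sup>2 / ((2 * of_nat n + 1) * (2 * of_nat n + 3)) *
      ((2 * of_nat j + 1) * (2 * of_nat j + 3) * weight a b n m j 0)"
proof -
  have pw: "a powi (int (j + 2) - int m) = a\<^sup>2 * a powi (int j - int m)"
    "b powi (int (j + 2) - int (n + 2)) = b powi (int j - int n)"
    using assms by (simp_all add: power_int_diff power_int_add field_simps power2_eq_square)
  have ph: "pochhammer (1/2) (i + 2) =
      (2 * of_nat i + 1) * (2 * of_nat i + 3) / 4 * (pochhammer (1/2) i :: complex)" for i
    by (simp add: pochhammer_half_Suc mult_ac add_ac)
  show ?thesis
    unfolding weight_def pw ph
    using two_of_nat_plus_odd_neq_0[of n] pochhammer_half_neq_0[of n] pochhammer_half_neq_0[of m]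
    by (simp add: divide_simps)
qed

lemma closed_form_beyond: "n + m < k \<Longrightarrow> closed_form a n m k = 0"
  by (simp add: closed_form_def)

text \<open>
  What \<open>P2 = P1 + e u^2 P0\<close> means for the expansion coefficients: by \<open>bessel_poly_rec\<close>,
  \<open>u^2 q_j = (2j+1)(2j+3) (q_(j+2) - q_(j+1))\<close>.
\<close>
definition three_term_coeffs ::
  "complex \<Rightarrow> (nat \<Rightarrow> complex) \<Rightarrow> (nat \<Rightarrow> complex) \<Rightarrow> (nat \<Rightarrow> complex) \<Rightarrow> bool" where
  "three_term_coeffs e c0 c1 c2 \<longleftrightarrow>
     c2 0 = c1 0 \<and>
     c2 1 = c1 1 - e * (3 * c0 0) \<and>
     (\<forall>j. c2 (j + 2) = c1 (j + 2) + e *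
        ((2 * of_nat j + 1) * (2 * of_nat j + 3) * c0 j -
         (2 * of_nat j + 3) * (2 * of_nat j + 5) * c0 (j + 1)))"

text \<open>
  Each index \<open>k\<close> is matched with the contiguous relation at \<open>l = n + m + 1 - k\<close>. For
  \<open>k \<le> 1\<close> the superfluous coefficients in it vanish by degree; for the top index \<open>k = n + m + 2\<close>, where
  \<open>l\<close> would be negative, the series enter only through their constant terms.
\<close>
lemma closed_form_three_term_left:
  assumes "a \<noteq> 0" "a \<noteq> 1"
  shows "three_term_coeffs (a\<^sup>2 / ((2 * of_nat n + 1) * (2 * of_nat n + 3)))
    (closed_form a n m) (closed_form a (n + 1) m) (closed_form a (n + 2) m)"
  unfolding three_term_coeffs_def
proof (intro conjI allI)
  have b: "1 - a \<noteq> 0"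
    using assms by simp
  let ?T = "\<lambda>N p d. fps_nth (binomial_product a N p) d"
  show "closed_form a (n + 2) m 0 = closed_form a (n + 1) m 0"
  proof -
    define l where "l = n + m + 1"
    have "?T l (of_nat (m + 1)) (2 * l + 2) = 0" "?T l (of_nat m) (2 * l) = 0"
      by (rule binomial_product_coeff_eq_0; simp add: l_def)+
    then have "(2 * of_nat l + 1) * ?T (l + 2) (of_nat m - 1) (2 * l + 2) =
        (2 * of_nat n + 3) * (1 - a) * ?T (l + 1) (of_nat m - 1) (2 * l)"
      using binomial_product_contiguous_left[of l a 0 "of_nat m - 1"]
      by (simp add: l_def algebra_simps)
    from weight_step_0[OF b this, of a m] show ?thesis
      using closed_form_eq[of "n + 2" m "l + 1" 0 a] closed_form_eq[of "n + 1" m l 0 a]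
      by (simp add: l_def)
  qed
  show "closed_form a (n + 2) m 1 = closed_form a (n + 1) m 1 -
      a\<^sup>2 / ((2 * of_nat n + 1) * (2 * of_nat n + 3)) * (3 * closed_form a n m 0)"
  proof -
    define l where "l = n + m"
    have "?T (l + 1) (of_nat m) (2 * l + 2) = 0"
      by (rule binomial_product_coeff_eq_0) (simp add: l_def)
    then have "(2 * of_nat l + 1) * ?T (l + 3) (of_nat m - 2) (2 * l + 2) =
        (2 * of_nat n + 3) * (1 - a) * ?T (l + 2) (of_nat m - 2) (2 * l) -
        3 * a * (1 - a) * ?T (l + 1) (of_nat m - 1) (2 * l)"
      using binomial_product_contiguous_left[of l a 1 "of_nat m - 2"]
      by (simp add: l_def eval_nat_numeral algebra_simps)
    from weight_step_1[OF assms(1) b this, of m] show ?thesis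
      using closed_form_eq[of "n + 2" m "l + 1" 1 a] closed_form_eq[of "n + 1" m l 1 a]
        closed_form_eq[of n m l 0 a]
      by (simp add: l_def eval_nat_numeral)
  qed
  fix j
  consider "n + m < j" | "j = n + m" | l where "n + m = l + j + 1"
    by (metis add.commute add.assoc less_imp_Suc_add linorder_neqE_nat Suc_eq_plus1)
  then show "closed_form a (n + 2) m (j + 2) = closed_form a (n + 1) m (j + 2) +
      a\<^sup>2 / ((2 * of_nat n + 1) * (2 * of_nat n + 3)) *
      ((2 * of_nat j + 1) * (2 * of_nat j + 3) * closed_form a n m j -
       (2 * of_nat j + 3) * (2 * of_nat j + 5) * closed_form a n m (j + 1))"
  proof cases
    case 1
    then show ?thesis
      by (simp add: closed_form_beyond)
  next
    case 2
    then show ?thesis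
      using closed_form_eq[of "n + 2" m 0 "j + 2" a] closed_form_eq[of n m 0 j a]
        weight_step_top[OF assms(1) b, of n m j]
      by (simp add: closed_form_beyond binomial_product_nth_0)
  next
    case (3 l)
    define p :: complex where "p = of_int (int m - int j - 3)"
    have n: "(of_nat n :: complex) = of_nat l + of_nat j + 1 - of_nat m"
      using arg_cong[OF 3, of "of_nat :: nat \<Rightarrow> complex"] by (simp add: algebra_simps)
    have "(2 * of_nat l + 1) * ?T (l + j + 4) p (2 * l + 2) =
        (2 * of_nat n + 3) * (1 - a) * ?T (l + j + 3) p (2 * l) +
        (2 * of_nat l + 1) * ?T (l + j + 2) (p + 2) (2 * l + 2) -
        (2 * of_nat j + 5) * a * (1 - a) * ?T (l + j + 2) (p + 1) (2 * l)"
    proof -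
      have "2 * of_nat l - 2 * p - 1 = 2 * of_nat n + 3"
        by (simp add: p_def n)
      then show ?thesis
        using binomial_product_contiguous_left[of l a "j + 2" p]
        by (simp add: eval_nat_numeral add_ac)
    qed
    note step = weight_step[OF assms(1) b this, of m]
    have "p + 2 = of_int (int m - int j - 1)" "p + 1 = of_int (int m - int (j + 1) - 1)"
      "p = of_int (int m - int (j + 2) - 1)"
      by (simp_all add: p_def)
    then show ?thesis
      using step 3 closed_form_eq[of "n + 2" m "l + 1" "j + 2" a] closed_form_eq[of "n + 1" m l "j + 2" a]
        closed_form_eq[of n m "l + 1" j a] closed_form_eq[of n m l "j + 1" a]
      by (simp add: eval_nat_numeral)
  qed
qed

lemma closed_form_three_term_right:
  assumes "a \<noteq> 0" "a \<noteq> 1"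
  shows "three_term_coeffs ((1 - a)\<^sup>2 / ((2 * of_nat m + 1) * (2 * of_nat m + 3)))
    (closed_form a n m) (closed_form a n (m + 1)) (closed_form a n (m + 2))"
  unfolding three_term_coeffs_def
proof (intro conjI allI)
  have b: "1 - a \<noteq> 0"
    using assms by simp
  let ?T = "\<lambda>N p d. fps_nth (binomial_product a N p) d"
  show "closed_form a n (m + 2) 0 = closed_form a n (m + 1) 0"
  proof -
    define l where "l = n + m + 1"
    have "?T l (of_nat (m + 1)) (2 * l + 2) = 0" "?T l (of_nat m) (2 * l) = 0"
      by (rule binomial_product_coeff_eq_0; simp add: l_def)+
    then have "(2 * of_nat l + 1) * ?T (l + 2) (of_nat m + 1) (2 * l + 2) =
        (2 * of_nat m + 3) * a * ?T (l + 1) (of_nat m) (2 * l)"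
      using binomial_product_contiguous_right[of l a 0 "of_nat m"]
      by (simp add: l_def algebra_simps)
    from weight_step_0[OF assms(1) this, of "1 - a" n] show ?thesis
      using closed_form_eq[of n "m + 2" "l + 1" 0 a] closed_form_eq[of n "m + 1" l 0 a]
      by (simp add: l_def weight_commute[of "1 - a"] add.commute)
  qed
  show "closed_form a n (m + 2) 1 = closed_form a n (m + 1) 1 -
      (1 - a)\<^sup>2 / ((2 * of_nat m + 1) * (2 * of_nat m + 3)) * (3 * closed_form a n m 0)"
  proof -
    define l where "l = n + m"
    have "?T (l + 1) (of_nat m) (2 * l + 2) = 0"
      by (rule binomial_product_coeff_eq_0) (simp add: l_def)
    then have "(2 * of_nat l + 1) * ?T (l + 3) (of_nat m) (2 * l + 2) =
        (2 * of_nat m + 3) * a * ?T (l + 2) (of_nat m - 1) (2 * l) -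
        3 * (1 - a) * a * ?T (l + 1) (of_nat m - 1) (2 * l)"
      using binomial_product_contiguous_right[of l a 1 "of_nat m - 1"]
      by (simp add: l_def eval_nat_numeral algebra_simps)
    from weight_step_1[OF b assms(1) this, of n] show ?thesis
      using closed_form_eq[of n "m + 2" "l + 1" 1 a] closed_form_eq[of n "m + 1" l 1 a]
        closed_form_eq[of n m l 0 a]
      by (simp add: l_def eval_nat_numeral weight_commute[of "1 - a"])
  qed
  fix j
  consider "n + m < j" | "j = n + m" | l where "n + m = l + j + 1"
    by (metis add.commute add.assoc less_imp_Suc_add linorder_neqE_nat Suc_eq_plus1)
  then show "closed_form a n (m + 2) (j + 2) = closed_form a n (m + 1) (j + 2) +
      (1 - a)\<^sup>2 / ((2 * of_nat m + 1) * (2 * of_nat m + 3)) *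
      ((2 * of_nat j + 1) * (2 * of_nat j + 3) * closed_form a n m j -
       (2 * of_nat j + 3) * (2 * of_nat j + 5) * closed_form a n m (j + 1))"
  proof cases
    case 1
    then show ?thesis
      by (simp add: closed_form_beyond)
  next
    case 2
    then show ?thesis
      using closed_form_eq[of n "m + 2" 0 "j + 2" a] closed_form_eq[of n m 0 j a]
        weight_step_top[OF b assms(1), of m n j]
      by (simp add: closed_form_beyond binomial_product_nth_0 weight_commute[of "1 - a"])
  next
    case (3 l)
    define p :: complex where "p = of_int (int m - int j - 2)"
    have "(2 * of_nat l + 1) * ?T (l + j + 4) (p + 1) (2 * l + 2) =
        (2 * of_nat m + 3) * a * ?T (l + j + 3) p (2 * l) +
        (2 * of_nat l + 1) * ?T (l + j + 2) (p + 1) (2 * l + 2) -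
        (2 * of_nat j + 5) * (1 - a) * a * ?T (l + j + 2) p (2 * l)"
    proof -
      have "2 * p + 2 * of_nat (j + 2) + 3 = 2 * of_nat m + 3"
        by (simp add: p_def)
      then show ?thesis
        using binomial_product_contiguous_right[of l a "j + 2" p]
        by (simp add: eval_nat_numeral mult_ac add_ac)
    qed
    note step = weight_step[OF b assms(1) this, of n, unfolded weight_commute[of "1 - a"]]
    have "p + 1 = of_int (int (m + 2) - int (j + 2) - 1)" "p + 1 = of_int (int m - int j - 1)"
      "p = of_int (int (m + 1) - int (j + 2) - 1)" "p = of_int (int m - int (j + 1) - 1)"
      by (simp_all add: p_def)
    then show ?thesis
      using step 3 closed_form_eq[of n "m + 2" "l + 1" "j + 2" a] closed_form_eq[of n "m + 1" l "j + 2" a]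
        closed_form_eq[of n m "l + 1" j a] closed_form_eq[of n m l "j + 1" a]
      by (simp add: eval_nat_numeral)
  qed
qed

section \<open>Expansion of the products\<close>

definition bessel_expansion :: "complex poly \<Rightarrow> nat \<Rightarrow> (nat \<Rightarrow> complex) \<Rightarrow> bool" where
  "bessel_expansion P N c \<longleftrightarrow> (\<forall>k>N. c k = 0) \<and> P = (\<Sum>k\<le>N. smult (c k) (bessel_poly k))"

lemma bessel_expansion_three_term:
  assumes P0: "bessel_expansion P0 N c0" and P1: "bessel_expansion P1 (N + 1) c1"
    and c: "three_term_coeffs e c0 c1 c2"
  shows "bessel_expansion (P1 + smult e (monom 1 2 * P0)) (N + 2) c2"
proof -
  let ?q = bessel_poly
  define r :: "nat \<Rightarrow> complex" where "r j = (2 * of_nat j + 1) * (2 * of_nat j + 3)" for j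
  have X2: "monom 1 2 * ?q k = smult (r k) (?q (k + 2) - ?q (k + 1))" for k
    using bessel_poly_rec[of k] two_of_nat_plus_odd_neq_0[of k] by (simp add: r_def)
  have c0: "c0 k = 0" if "N < k" for k
    using P0 that by (simp add: bessel_expansion_def)
  have c1: "c1 k = 0" if "N + 1 < k" for k
    using P1 that by (simp add: bessel_expansion_def)
  have c2: "c2 (j + 2) = c1 (j + 2) + e * (r j * c0 j - r (Suc j) * c0 (Suc j))" for j
  proof -
    have "r (Suc j) = (2 * of_nat j + 3) * (2 * of_nat j + 5)"
      by (simp add: r_def algebra_simps)
    moreover have "c2 (j + 2) = c1 (j + 2) + e * (r j * c0 j -
        (2 * of_nat j + 3) * (2 * of_nat j + 5) * c0 (j + 1))"
      using c unfolding three_term_coeffs_def r_def by blast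
    ultimately show ?thesis
      by (simp only: Suc_eq_plus1)
  qed
  have shift: "(\<Sum>k\<le>M + 2. g k) = g 0 + g 1 + (\<Sum>j\<le>M. g (j + 2))"
    for g :: "nat \<Rightarrow> complex poly" and M
    by (simp add: sum.atMost_Suc_shift del: sum.atMost_Suc)
  have "monom 1 2 * P0 = (\<Sum>j\<le>N. smult (c0 j) (monom 1 2 * ?q j))"
    using P0 by (simp add: bessel_expansion_def sum_distrib_left)
  also have "\<dots> = (\<Sum>j\<le>N. smult (r j * c0 j) (?q (j + 2))) -
      (\<Sum>j\<le>N. smult (r j * c0 j) (?q (Suc j)))"
    unfolding X2 by (simp add: smult_diff_right mult.commute flip: sum_subtractf)
  also have "(\<Sum>j\<le>N. smult (r j * c0 j) (?q (Suc j))) =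
      (\<Sum>j\<le>Suc N. smult (r j * c0 j) (?q (Suc j)))"
    by (simp add: c0)
  also have "\<dots> = smult (r 0 * c0 0) (?q 1) + (\<Sum>j\<le>N. smult (r (Suc j) * c0 (Suc j)) (?q (j + 2)))"
    by (simp add: sum.atMost_Suc_shift del: sum.atMost_Suc)
  finally have X2P0: "monom 1 2 * P0 =
      (\<Sum>j\<le>N. smult (r j * c0 j - r (Suc j) * c0 (Suc j)) (?q (j + 2))) - smult (r 0 * c0 0) (?q 1)"
    by (simp add: smult_diff_left sum_subtractf)
  have "P1 = (\<Sum>k\<le>N + 2. smult (c1 k) (?q k))"
    using P1 by (simp add: bessel_expansion_def c1)
  also have "\<dots> = smult (c1 0) (?q 0) + smult (c1 1) (?q 1) + (\<Sum>j\<le>N. smult (c1 (j + 2)) (?q (j + 2)))"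
    by (rule shift)
  finally have P1_eq: "P1 = \<dots>" .
  have "P1 + smult e (monom 1 2 * P0) = smult (c2 0) (?q 0) + smult (c2 1) (?q 1) +
      (\<Sum>j\<le>N. smult (c2 (j + 2)) (?q (j + 2)))"
  proof -
    have "smult e (\<Sum>j\<le>N. g j) = (\<Sum>j\<le>N. smult e (g j))" for g :: "nat \<Rightarrow> complex poly"
      by (induction N) (simp_all add: smult_add_right)
    moreover have "c2 0 = c1 0" "c2 1 = c1 1 - e * (r 0 * c0 0)"
      using c by (simp_all add: three_term_coeffs_def r_def)
    ultimately show ?thesis
      unfolding P1_eq X2P0 c2
      by (simp add: smult_add_left smult_diff_left smult_diff_right right_diff_distrib sum.distrib)
  qed
  then show ?thesis
    unfolding bessel_expansion_def shift
  proof (intro conjI allI impI)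
    fix k assume "N + 2 < k"
    then obtain j where "k = j + 2" "N < j"
      by (metis add_less_cancel_right less_add_same_cancel2 less_imp_add_positive add.commute add.assoc)
    then show "c2 k = 0"
      using c2[of j] by (simp add: c0 c1)
  qed
qed

lemma pcompose_bessel_poly_rec:
  "pcompose (bessel_poly (n + 2)) [:0, c:] = pcompose (bessel_poly (n + 1)) [:0, c:] +
     smult (c\<^sup>2 / ((2 * of_nat n + 1) * (2 * of_nat n + 3)))
       (monom 1 2 * pcompose (bessel_poly n) [:0, c:])"
proof -
  have "pcompose (monom 1 2) [:0, c:] = smult (c\<^sup>2) (monom 1 2)"
    by (simp add: monom_altdef pcompose_pCons power2_eq_square numeral_2_eq_2)
  then show ?thesis
    unfolding bessel_poly_rec[of n] pcompose_add pcompose_smult pcompose_mult by simp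
qed

lemma bessel_poly_0: "bessel_poly 0 = [:1:]"
  by (simp add: bessel_poly_def monom_0)

lemma bessel_poly_Suc_0: "bessel_poly (Suc 0) = [:1, 1:]"
  by (simp add: bessel_poly_def monom_0 monom_Suc)

lemma bessel_poly_2: "bessel_poly 2 = [:1, 1, 1/3:]"
  using bessel_poly_rec[of 0]
  by (simp add: bessel_poly_0 bessel_poly_Suc_0 monom_Suc monom_0 eval_nat_numeral)

text \<open>
  The four initial products. The recurrences reach back two steps in each variable, so both values
  \<open>0\<close> and \<open>1\<close> are needed.
\<close>
lemma bessel_expansion_closed_form_base:
  assumes "a \<noteq> 0" "a \<noteq> 1" "n \<le> 1" "m \<le> 1"
  shows "bessel_expansion (pcompose (bessel_poly n) [:0, a:] * pcompose (bessel_poly m) [:0, 1 - a:])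
    (n + m) (closed_form a n m)"
proof -
  have b: "1 - a \<noteq> 0"
    using assms by simp
  have gb2: "x gchoose Suc (Suc 0) = x * (x - 1) / 2" for x :: complex
    by (simp add: gbinomial_Suc atLeast0_atMost_Suc)
  have T2: "fps_nth (binomial_product a N p) 2 =
      of_nat N * (of_nat N - 1) / 2 * a\<^sup>2 + of_nat N * a * p + p * (p - 1) / 2" for N p
    by (simp add: binomial_product_nth numeral_2_eq_2 gb2)
  have T4: "fps_nth (binomial_product a 3 0) 4 = 0"
    using binomial_product_coeff_eq_0[of 3 0 4 a] by simp
  consider "n = 0" "m = 0" | "n = 1" "m = 0" | "n = 0" "m = 1" | "n = 1" "m = 1"
    using assms(3,4) by linarith
  then show ?thesis
  proof cases
    case 1
    then show ?thesis
      by (simp add: bessel_expansion_def closed_form_def weight_def binomial_product_nth_0 bessel_poly_0)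
  next
    case 2
    have "closed_form a 1 0 0 = 1 - a" "closed_form a 1 0 1 = a"
      using assms(1) b
      by (simp_all add: closed_form_def weight_def binomial_product_nth_0 T2
          T2[unfolded numeral_2_eq_2] power_int_minus field_simps power2_eq_square)
    with 2 show ?thesis
      by (simp add: bessel_expansion_def closed_form_beyond bessel_poly_0 bessel_poly_Suc_0 pcompose_pCons)
  next
    case 3
    have "closed_form a 0 1 0 = a" "closed_form a 0 1 1 = 1 - a"
      using assms(1) b
      by (simp_all add: closed_form_def weight_def binomial_product_nth_0 T2
          T2[unfolded numeral_2_eq_2] power_int_minus field_simps power2_eq_square)
    with 3 show ?thesis
      by (simp add: bessel_expansion_def closed_form_beyond bessel_poly_0 bessel_poly_Suc_0 pcompose_pCons)
  next
    case 4
    have c: "closed_form a 1 1 0 = 0" "closed_form a 1 1 1 = 1 - 3 * a * (1 - a)"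
      "closed_form a 1 1 2 = 3 * a * (1 - a)"
    proof -
      show "closed_form a 1 1 0 = 0"
        by (simp add: closed_form_def T4[unfolded numeral_3_eq_3])
      show "closed_form a 1 1 1 = 1 - 3 * a * (1 - a)"
        by (simp add: closed_form_def weight_def T2) (simp add: field_simps power2_eq_square)?
      show "closed_form a 1 1 2 = 3 * a * (1 - a)"
        using pochhammer_half_Suc[of "Suc 0"]
        by (simp add: closed_form_def weight_def binomial_product_nth_0 numeral_2_eq_2)
    qed
    have "{..1 + 1 :: nat} = {0, 1, 2}"
      by auto
    then have "(\<Sum>k\<le>1 + 1. smult (closed_form a 1 1 k) (bessel_poly k)) =
        smult (1 - 3 * a * (1 - a)) [:1, 1:] + smult (3 * a * (1 - a)) [:1, 1, 1/3:]"
      using c bessel_poly_2 bessel_poly_Suc_0 by simp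
    also have "\<dots> = [:1, a:] * [:1, 1 - a:]"
      by (simp add: algebra_simps)
    finally show ?thesis
      using 4 by (simp add: bessel_expansion_def closed_form_beyond bessel_poly_Suc_0 pcompose_pCons)
  qed
qed

lemma bessel_expansion_closed_form:
  assumes "a \<noteq> 0" "a \<noteq> 1"
  shows "bessel_expansion (pcompose (bessel_poly n) [:0, a:] * pcompose (bessel_poly m) [:0, 1 - a:])
    (n + m) (closed_form a n m)"
proof -
  define F where "F n c = pcompose (bessel_poly n) [:0, c:]" for n c
  have step_left: "bessel_expansion (F (n + 2) a * F m (1 - a)) (n + 2 + m) (closed_form a (n + 2) m)"
    if "bessel_expansion (F n a * F m (1 - a)) (n + m) (closed_form a n m)"
      "bessel_expansion (F (n + 1) a * F m (1 - a)) (n + 1 + m) (closed_form a (n + 1) m)" for n m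
    using bessel_expansion_three_term[OF that(1) _ closed_form_three_term_left[OF assms, of n m]] that(2)
    by (simp add: F_def pcompose_bessel_poly_rec[of n, simplified] distrib_right mult.assoc)
  have step_right: "bessel_expansion (F n a * F (m + 2) (1 - a)) (n + (m + 2)) (closed_form a n (m + 2))"
    if "bessel_expansion (F n a * F m (1 - a)) (n + m) (closed_form a n m)"
      "bessel_expansion (F n a * F (m + 1) (1 - a)) (n + (m + 1)) (closed_form a n (m + 1))" for n m
    using bessel_expansion_three_term[OF that(1) _ closed_form_three_term_right[OF assms, of m n]] that(2)
    by (simp add: F_def pcompose_bessel_poly_rec[of m, simplified] distrib_left mult.left_commute)
  \<comment> \<open>Induction on \<open>m\<close> for \<open>n \<le> 1\<close> supplies the initial values of the induction on \<open>n\<close>.\<close>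
  have low: "bessel_expansion (F n a * F m (1 - a)) (n + m) (closed_form a n m)" if "n \<le> 1" for n m
  proof (induction m rule: induct_nat_012)
    case (ge2 m)
    then show ?case
      using step_right[of n m] by simp
  next
    case 0
    show ?case
      using bessel_expansion_closed_form_base[OF assms that, of 0] by (simp add: F_def)
  next
    case 1
    show ?case
      using bessel_expansion_closed_form_base[OF assms that, of 1] by (simp add: F_def)
  qed
  have "bessel_expansion (F n a * F m (1 - a)) (n + m) (closed_form a n m)"
  proof (induction n rule: induct_nat_012)
    case (ge2 n)
    then show ?case
      using step_left[of n m] by simp
  qed (use low[of 0 m] low[of 1 m] in simp_all)
  then show ?thesis
    by (simp only: F_def)
qed

lemma bessel_lin_coeff_eq_closed_form:
  assumes "a \<noteq> 0" "a \<noteq> 1"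
  shows "bessel_lin_coeff n m a = closed_form a n m"
  unfolding bessel_lin_coeff_def
  by (rule the1_equality[OF bessel_lin_coeff_ex1])
     (use bessel_expansion_closed_form[OF assms] in \<open>simp add: bessel_expansion_def\<close>)

section \<open>Hypergeometric forms\<close>

lemma gbinomial_Suc_mult: "(x gchoose Suc i) * (of_nat i + 1) = (x gchoose i) * (x - of_nat i)"
  for x :: "'a :: field_char_0"
  using gbinomial_absorption[of i x] gbinomial_absorb_comp[of x i] by (simp add: mult.commute add.commute)

lemma gbinomial_diff_pochhammer:
  fixes x :: "'a :: field_char_0"
  assumes "j \<le> d"
  shows "(x gchoose (d - j)) * pochhammer (x - of_nat d + 1) j =
    (x gchoose d) * ((- 1) ^ j * pochhammer (- of_nat d) j)"
  using assms
proof (induction j)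
  case (Suc j)
  define e where "e = d - Suc j"
  have d: "d = e + Suc j" "d - j = Suc e" "d - Suc j = e"
    using Suc.prems by (simp_all add: e_def)
  have "(x gchoose e) * pochhammer (x - of_nat d + 1) (Suc j) =
      pochhammer (x - of_nat d + 1) j * ((x gchoose e) * (x - of_nat e))"
    by (simp add: pochhammer_Suc d(1) algebra_simps)
  also have "\<dots> = ((x gchoose Suc e) * pochhammer (x - of_nat d + 1) j) * (of_nat e + 1)"
    by (simp add: mult_ac flip: gbinomial_Suc_mult)
  also have "(x gchoose Suc e) * pochhammer (x - of_nat d + 1) j =
      (x gchoose d) * ((- 1) ^ j * pochhammer (- of_nat d) j)"
    using Suc by (simp add: d(2))
  also have "\<dots> * (of_nat e + 1) = (x gchoose d) * ((- 1) ^ Suc j * pochhammer (- of_nat d) (Suc j))"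
    by (simp add: pochhammer_Suc d(1) algebra_simps)
  finally show ?case
    by (simp only: d(3))
qed simp

lemma gbinomial_add_pochhammer:
  fixes x :: "'a :: field_char_0"
  shows "(x gchoose (r + i)) * pochhammer (of_nat r + 1) i =
    (x gchoose r) * ((- 1) ^ i * pochhammer (of_nat r - x) i)"
proof (induction i)
  case (Suc i)
  have "(x gchoose (r + Suc i)) * pochhammer (of_nat r + 1) (Suc i) =
      ((x gchoose Suc (r + i)) * (of_nat (r + i) + 1)) * pochhammer (of_nat r + 1) i"
    by (simp add: pochhammer_Suc algebra_simps)
  also have "\<dots> = ((x gchoose (r + i)) * pochhammer (of_nat r + 1) i) * (x - of_nat (r + i))"
    by (simp only: gbinomial_Suc_mult mult_ac)
  also have "\<dots> = (x gchoose r) * ((- 1) ^ Suc i * pochhammer (of_nat r - x) (Suc i))"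
    unfolding Suc.IH by (simp add: pochhammer_Suc algebra_simps)
  finally show ?case .
qed simp

lemma hypergeo_2F1_terminating:
  "hypergeo_2F1 (- of_nat d) B C z =
     (\<Sum>j = 0..d. pochhammer (- of_nat d) j * pochhammer B j / (pochhammer C j * fact j) * z ^ j)"
  unfolding hypergeo_2F1_def
  by (rule suminf_finite) (auto simp: pochhammer_of_nat_eq_0_iff)

lemma pochhammer_pos_int_neq_0:
  "0 < c \<Longrightarrow> pochhammer (of_int c) j \<noteq> (0 :: complex)"
proof
  assume c: "0 < c" and "pochhammer (of_int c) j = (0 :: complex)"
  then obtain i where "of_int c = - (of_nat i :: complex)"
    by (auto simp: pochhammer_eq_0_iff)
  then have "of_int (c + int i) = (0 :: complex)"
    by simp
  then show False
    using c by (simp only: of_int_eq_0_iff)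
qed

text \<open>
  The hypergeometric form normalised at the term \<open>j = 0\<close>; it is meaningful when no denominator
  parameter vanishes.
\<close>
lemma binomial_sum_eq_2F1_top:
  fixes x y z :: complex
  assumes "\<And>j. pochhammer (x - of_nat d + 1) j \<noteq> 0"
  shows "(\<Sum>j = 0..d. (x gchoose (d - j)) * (y gchoose j) * z ^ j) =
    (x gchoose d) * hypergeo_2F1 (- of_nat d) (- y) (x - of_nat d + 1) z"
  unfolding hypergeo_2F1_terminating sum_distrib_left
proof (rule sum.cong)
  fix j assume "j \<in> {0..d}"
  then have "x gchoose (d - j) = (x gchoose d) * ((- 1) ^ j * pochhammer (- of_nat d) j) /
      pochhammer (x - of_nat d + 1) j"
    using assms[of j] by (subst gbinomial_diff_pochhammer[symmetric]) auto
  then show "(x gchoose (d - j)) * (y gchoose j) * z ^ j = (x gchoose d) *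
     (pochhammer (- of_nat d) j * pochhammer (- y) j / (pochhammer (x - of_nat d + 1) j * fact j) * z ^ j)"
    by (simp add: gbinomial_pochhammer[of y])
qed simp

text \<open>
  For \<open>j < r\<close> the lower index \<open>r + N - j\<close> exceeds \<open>N\<close> and the term vanishes, so the series is
  normalised at \<open>j = r\<close>.
\<close>
lemma binomial_sum_eq_2F1_tail:
  fixes y z :: complex
  shows "(\<Sum>j = 0..r + N. (of_nat N gchoose (r + N - j)) * (y gchoose j) * z ^ j) =
    (y gchoose r) * z ^ r * hypergeo_2F1 (- of_nat N) (of_nat r - y) (of_nat r + 1) z"
proof -
  have nz: "pochhammer (of_nat r + 1) i \<noteq> (0 :: complex)" for i
    using pochhammer_pos_int_neq_0[of "int r + 1" i] by simp
  have "(\<Sum>j = 0..r + N. (of_nat N gchoose (r + N - j)) * (y gchoose j) * z ^ j) =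
      (\<Sum>j = r..r + N. (of_nat N gchoose (r + N - j)) * (y gchoose j) * z ^ j)"
    by (rule sum.mono_neutral_right) (auto simp flip: binomial_gbinomial)
  also have "\<dots> = (\<Sum>i = 0..N. (of_nat N gchoose (N - i)) * (y gchoose (r + i)) * z ^ (r + i))"
    using sum.shift_bounds_cl_nat_ivl[of "\<lambda>j. (of_nat N gchoose (r + N - j)) * (y gchoose j) * z ^ j" 0 r N]
    by (simp add: add.commute)
  also have "\<dots> = (\<Sum>i = 0..N. (y gchoose r) * z ^ r * (pochhammer (- of_nat N) i * pochhammer (of_nat r - y) i /
      (pochhammer (of_nat r + 1) i * fact i) * z ^ i))"
  proof (rule sum.cong)
    fix i assume "i \<in> {0..N}"
    then have "(of_nat N gchoose (N - i) :: complex) = (- 1) ^ i * pochhammer (- of_nat N) i / fact i"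
      using gbinomial_of_nat_symmetric[of i N, where 'a = complex]
      by (simp add: gbinomial_pochhammer[of _ i])
    moreover have "y gchoose (r + i) = (y gchoose r) * ((- 1) ^ i * pochhammer (of_nat r - y) i) /
        pochhammer (of_nat r + 1) i"
      using nz[of i] by (simp flip: gbinomial_add_pochhammer)
    ultimately show "(of_nat N gchoose (N - i)) * (y gchoose (r + i)) * z ^ (r + i) =
      (y gchoose r) * z ^ r * (pochhammer (- of_nat N) i * pochhammer (of_nat r - y) i /
      (pochhammer (of_nat r + 1) i * fact i) * z ^ i)"
      by (simp add: power_add mult_ac)
  qed simp
  finally show ?thesis
    by (simp add: hypergeo_2F1_terminating sum_distrib_left)
qed

lemma closed_form_eq_sum:
  assumes a: "a \<noteq> 0" and k: "k \<le> n + m"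
  shows "closed_form a n m k =
    a powi (2 * int n + int m - int k) * (1 - a) powi (- int n + int k) *
    (pochhammer (1/2) (n + m - k) * pochhammer (1/2) k /
      (pochhammer (1/2) n * pochhammer (1/2) m)) *
    (\<Sum>j = 0..2 * (n + m - k). (of_nat (n + m + 1) gchoose (2 * (n + m - k) - j)) *
      (of_int (int m - int k - 1) gchoose j) * (1 / a) ^ j)"
proof -
  define d where "d = 2 * (n + m - k)"
  have "fps_nth (binomial_product a (n + m + 1) (of_int (int m - int k - 1))) d =
      (\<Sum>j = 0..d. a ^ d * ((of_nat (n + m + 1) gchoose (d - j)) *
        (of_int (int m - int k - 1) gchoose j) * (1 / a) ^ j))"
    unfolding binomial_product_nth
  proof (rule sum.cong)
    fix j assume "j \<in> {0..d}"
    then have "a ^ (d - j) = a ^ d * (1 / a) ^ j"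
      using a by (simp add: power_diff power_one_over field_simps)
    then show "(of_nat (n + m + 1) gchoose (d - j)) * a ^ (d - j) * (of_int (int m - int k - 1) gchoose j) =
        a ^ d * ((of_nat (n + m + 1) gchoose (d - j)) * (of_int (int m - int k - 1) gchoose j) * (1 / a) ^ j)"
      by (simp only: mult_ac)
  qed simp
  moreover have "a powi (2 * int n + int m - int k) = a powi (int k - int m) * a ^ d"
  proof -
    have "2 * int n + int m - int k = (int k - int m) + int d"
      using k by (simp add: d_def)
    then show ?thesis
      using a by (simp only: power_int_add power_int_of_nat simp_thms)
  qed
  ultimately show ?thesis
    using k by (simp add: closed_form_def weight_def sum_distrib_left mult_ac flip: d_def)
qed

theorem theorem1:
  fixes n m k :: nat and a :: complex
  assumes "a \<noteq> 0" and "a \<noteq> 1" and "k \<le> n + m"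
  shows
    "bessel_lin_coeff n m a k =
       a powi (2 * int n + int m - int k) * (1 - a) powi (- int n + int k) *
       (pochhammer (1/2) (n + m - k) * pochhammer (1/2) k /
         (pochhammer (1/2) n * pochhammer (1/2) m)) *
       (\<Sum>j = 0..2 * (n + m - k).
          (-1) ^ j *
          (of_int (int n + int m + 1) gchoose (2 * (n + m - k) - j)) *
          (of_int (- int m + int k + int j) gchoose j) *
          a powi (- int j))
     \<and>
     (int k \<ge> \<lceil>(real n + real m - 1) / 2\<rceil> \<longrightarrow>
       bessel_lin_coeff n m a k =
       a powi (2 * int n + int m - int k) * (1 - a) powi (- int n + int k) *
       (pochhammer (1/2) (n + m - k) * pochhammer (1/2) k /
         (pochhammer (1/2) n * pochhammer (1/2) m)) *
       (of_int (int n + int m + 1) gchoose (2 * (n + m - k))) *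
       hypergeo_2F1 (of_int (- 2 * int m - 2 * int n + 2 * int k))
         (of_int (- int m + int k + 1))
         (of_int (2 * int k - int m - int n + 2)) (1 / a))
     \<and>
     (int k \<le> \<lfloor>(real n + real m - 1) / 2\<rfloor> \<longrightarrow>
       bessel_lin_coeff n m a k =
       (-1) powi (int n + int m - 1) *
       a powi (int n + int k + 1) * (1 - a) powi (- int n + int k) *
       (pochhammer (1/2) (n + m - k) * pochhammer (1/2) k /
         (pochhammer (1/2) n * pochhammer (1/2) m)) *
       (of_int (int n - int k - 1) gchoose (n + m - 2 * k - 1)) *
       hypergeo_2F1 (of_int (- int m - int n - 1)) (of_int (int n - int k))
         (of_int (int n + int m - 2 * int k)) (1 / a))"
proof -
  define d where "d = 2 * (n + m - k)"
  define x y :: complex where "x = of_nat (n + m + 1)" and "y = of_int (int m - int k - 1)"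
  define S where "S = (\<Sum>j = 0..d. (x gchoose (d - j)) * (y gchoose j) * (1 / a) ^ j)"
  define Q :: complex where "Q = pochhammer (1/2) (n + m - k) * pochhammer (1/2) k /
         (pochhammer (1/2) n * pochhammer (1/2) m)"
  have lin: "bessel_lin_coeff n m a k =
      a powi (2 * int n + int m - int k) * (1 - a) powi (- int n + int k) * Q * S"
    using closed_form_eq_sum[OF assms(1,3)] bessel_lin_coeff_eq_closed_form[OF assms(1,2), of n m]
    by (simp only: S_def Q_def x_def y_def d_def)
  have x: "of_int (int n + int m + 1) = x"
    by (simp add: x_def)
  have S1: "(\<Sum>j = 0..2 * (n + m - k). (-1) ^ j *
          (of_int (int n + int m + 1) gchoose (2 * (n + m - k) - j)) *
          (of_int (- int m + int k + int j) gchoose j) * a powi (- int j)) = S"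
    unfolding S_def x d_def[symmetric]
  proof (rule sum.cong)
    fix j
    have "y gchoose j = (- 1) ^ j * (of_int (- int m + int k + int j) gchoose j)"
      by (subst gbinomial_negated_upper) (simp add: y_def algebra_simps)
    then show "(-1) ^ j * (x gchoose (d - j)) * (of_int (- int m + int k + int j) gchoose j) *
        a powi (- int j) = (x gchoose (d - j)) * (y gchoose j) * (1 / a) ^ j"
      by (simp add: power_int_minus power_one_over field_simps)
  qed simp
  \<comment> \<open>Here \<open>x - d + 1 = 2 k - m - n + 2\<close> is positive, so that the series is well defined.\<close>
  have S2: "S = (x gchoose d) * hypergeo_2F1 (of_int (- 2 * int m - 2 * int n + 2 * int k))
         (of_int (- int m + int k + 1)) (of_int (2 * int k - int m - int n + 2)) (1 / a)"
    if "n + m \<le> 2 * k + 1"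
  proof -
    have c: "x - of_nat d + 1 = of_int (2 * int k - int m - int n + 2)"
      using assms(3) by (simp add: x_def d_def of_nat_diff)
    have nz: "pochhammer (x - of_nat d + 1) j \<noteq> 0" for j
      unfolding c using that by (intro pochhammer_pos_int_neq_0) linarith
    have "of_int (- 2 * int m - 2 * int n + 2 * int k) = - (of_nat d :: complex)"
      using assms(3) by (simp add: d_def of_nat_diff)
    moreover have "of_int (- int m + int k + 1) = - y"
      by (simp add: y_def)
    ultimately show ?thesis
      unfolding S_def using binomial_sum_eq_2F1_top[OF nz, of y "1 / a"] by (simp only: c)
  qed
  have S3: "a powi (2 * int n + int m - int k) * S =
      (-1) powi (int n + int m - 1) * a powi (int n + int k + 1) *
       (of_int (int n - int k - 1) gchoose (n + m - 2 * k - 1)) *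
       hypergeo_2F1 (of_int (- int m - int n - 1)) (of_int (int n - int k))
         (of_int (int n + int m - 2 * int k)) (1 / a)"
    if "2 * k + 1 \<le> n + m"
  proof -
    define r where "r = n + m - 2 * k - 1"
    have d: "d = r + (n + m + 1)" and r: "int r = int n + int m - 2 * int k - 1"
      using that by (simp_all add: r_def d_def)
    have args: "of_int (- int m - int n - 1) = - (of_nat (n + m + 1) :: complex)"
      "of_int (int n - int k) = of_nat r - y"
      "of_int (int n + int m - 2 * int k) = (of_nat r + 1 :: complex)"
      using arg_cong[OF r, of "of_int :: int \<Rightarrow> complex"] by (simp_all add: y_def)
    have S: "S = (y gchoose r) * (1 / a) ^ r * hypergeo_2F1 (of_int (- int m - int n - 1))
        (of_int (int n - int k)) (of_int (int n + int m - 2 * int k)) (1 / a)"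
      unfolding S_def x_def d args by (rule binomial_sum_eq_2F1_tail)
    \<comment> \<open>The stated binomial coefficient is the reflection of the one at which the tail starts; the
      reflection produces the sign \<open>(-1)^(n+m-1)\<close>.\<close>
    have y: "y gchoose r = (-1) ^ r * (of_int (int n - int k - 1) gchoose r)"
    proof -
      have "of_nat r - y - 1 = of_int (int n - int k - 1)"
        unfolding args(2)[symmetric] by simp
      then show ?thesis
        by (subst gbinomial_negated_upper) simp
    qed
    have sign: "(-1) powi (int n + int m - 1) = ((-1) ^ r :: complex)"
    proof -
      have "int n + int m - 1 = int (r + 2 * k)"
        using r by simp
      then show ?thesis
        by (simp only: power_int_of_nat) (simp add: power_add power_mult)
    qed
    have "a powi (2 * int n + int m - int k) = a powi (int n + int k + 1) * a ^ r"
    proof -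
      have "2 * int n + int m - int k = (int n + int k + 1) + int r"
        using r by simp
      then show ?thesis
        using assms(1) by (simp only: power_int_add power_int_of_nat simp_thms)
    qed
    then have shift: "a powi (2 * int n + int m - int k) * (1 / a) ^ r = a powi (int n + int k + 1)"
      using assms(1) by (simp add: power_one_over)
    have reorder: "p * (s * g * w * h) = s * (p * w) * g * h" for p s g w h :: complex
      by (simp only: mult_ac)
    show ?thesis
      unfolding S y sign r_def[symmetric] by (simp only: reorder shift)
  qed
  show ?thesis
  proof (intro conjI impI)
    show "bessel_lin_coeff n m a k = a powi (2 * int n + int m - int k) * (1 - a) powi (- int n + int k) *
       (pochhammer (1/2) (n + m - k) * pochhammer (1/2) k /
         (pochhammer (1/2) n * pochhammer (1/2) m)) *
       (\<Sum>j = 0..2 * (n + m - k). (-1) ^ j *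
          (of_int (int n + int m + 1) gchoose (2 * (n + m - k) - j)) *
          (of_int (- int m + int k + int j) gchoose j) * a powi (- int j))"
      unfolding S1 lin Q_def ..
  next
    assume "int k \<ge> \<lceil>(real n + real m - 1) / 2\<rceil>"
    then have "n + m \<le> 2 * k + 1"
      by (simp add: ceiling_le_iff)
    from S2[OF this] show "bessel_lin_coeff n m a k =
       a powi (2 * int n + int m - int k) * (1 - a) powi (- int n + int k) *
       (pochhammer (1/2) (n + m - k) * pochhammer (1/2) k /
         (pochhammer (1/2) n * pochhammer (1/2) m)) *
       (of_int (int n + int m + 1) gchoose (2 * (n + m - k))) *
       hypergeo_2F1 (of_int (- 2 * int m - 2 * int n + 2 * int k))
         (of_int (- int m + int k + 1))
         (of_int (2 * int k - int m - int n + 2)) (1 / a)"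
      by (simp only: lin Q_def x d_def mult.assoc)
  next
    assume "int k \<le> \<lfloor>(real n + real m - 1) / 2\<rfloor>"
    then have "2 * k + 1 \<le> n + m"
      by (simp add: le_floor_iff)
    note S3 = S3[OF this]
    have reorder: "p * q * w * s = (p * s) * (q * w)" for p q s w :: complex
      by (simp only: mult_ac)
    show "bessel_lin_coeff n m a k =
       (-1) powi (int n + int m - 1) *
       a powi (int n + int k + 1) * (1 - a) powi (- int n + int k) *
       (pochhammer (1/2) (n + m - k) * pochhammer (1/2) k /
         (pochhammer (1/2) n * pochhammer (1/2) m)) *
       (of_int (int n - int k - 1) gchoose (n + m - 2 * k - 1)) *
       hypergeo_2F1 (of_int (- int m - int n - 1)) (of_int (int n - int k))
         (of_int (int n + int m - 2 * int k)) (1 / a)"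
      unfolding lin Q_def[symmetric] reorder[of _ _ _ S] S3 by (simp only: mult_ac)
  qed
qed

end
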